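(* Let $\mathcal C_1,\mathcal C_2$ be Mixed Interfaces over the alphabet $\Sigma$. If $\mathcal C_1\preceq\mathcal C_2$, then every model of $\mathcal C_1$ is also a model of $\mathcal C_2$.
   Context: Mixed systems: $S=((\Omega,\pi),X,C)$ with $(\Omega,\pi)$ a probability space, $\Omega$ finite or countable, $X$ a finite set of variables with finite or countable domains $Q_x$, state set $Q=\prod_{x\in X}Q_x$, and $C\subseteq\Omega\times Q$; $\mathcal S(X)$ is the set of all mixed systems over $X$. $S$ is consistent if $\pi(\{\omega:\exists q,(\omega,q)\in C\})>0$. Lifting of $\rho\subseteq Q_1\times Q_2$: $S_1\,\rho^{\mathcal S}\,S_2$ iff there is $w:\Omega_1\times\Omega_2\to[0,1]$ with marginals $\pi_1$ and $\pi_2$ such that $w(\omega_1,\omega_2)>0$ and $(\omega_1,q_1)\in C_1$ imply the existence of $q_2$ with $(\omega_2,q_2)\in C_2$ and $q_1\,\rho\,q_2$. For sets of mixed systems: $\mathcal S_1\subseteq^{\rho}\mathcal S_2$ iff every $S_1\in\mathcal S_1$ has some $S_2\in\mathcal S_2$ with $S_1\,\rho^{\mathcal S}\,S_2$; $S\in^{\rho}\mathcal S$ means $\{S\}\subseteq^\rho\mathcal S$. An MMDP is $M=(\Sigma,X_M,r_0,\to)$ with variables $X_M$, state space $R=\prod_{x\in X_M}R_x$, $r_0\in R$, and deterministic transition relation $\to\subseteq R\times\Sigma\times\mathcal S(X_M)$ (at most one target per $(r,\alpha)$); it is live if all its transitions target consistent mixed systems. A Mixed Interface is $\mathcal C=(\Sigma,X,q_0,\to,\dashrightarrow)$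 with $X$ a finite set of variables with finite domains, state space $Q=\prod_{x\in X}Q_x$, initial state $q_0$ (not required to lie in $Q$), and deterministic must/may transition relations $\to,\dashrightarrow\subseteq Q\times\Sigma\times2^{\mathcal S(X)}$. Satisfaction: for a live MMDP $M$ and Mixed Interface $\mathcal C$ with $q_0\in Q$, a relation $\models\,\subseteq R\times Q$ is a satisfaction relation if whenever $r\models q$: (i) for all $\alpha$, $r\xrightarrow{\alpha}S_M$ implies $q\overset{\alpha}{\dashrightarrow}\mathcal S^\diamond$ for some $\mathcal S^\diamond$ with $S_M\in^{\models}\mathcal S^\diamond$; (ii) for all $\alpha$, $q\xrightarrow{\alpha}\mathcal S^\Box$ implies $r\xrightarrow{\alpha}S_M$ for some $S_M$ with $S_M\in^{\models}\mathcal S^\Box$. $M$ is a model of $\mathcal C$ if $q_0\in Q$ and some satisfaction relation has $r_0\models q_0$; if $q_0\notin Q$, $\mathcal C$ has no model. Modal refinement: $\preceq\,\subseteq Q_1\times Q_2$ is a modal refinement if for all $q_1\preceq q_2$, $\alpha$: $q_1\overset{\alpha}{\dashrightarrow}_1\mathcal S^\diamond_1$ implies $q_2\overset{\alpha}{\dashrightarrow}_2\mathcal S^\diamond_2$ with $\mathcal S^\diamond_1\subseteq^{\preceq}\mathcal S^\diamond_2$; and $q_2\xrightarrow{\alpha}_2\mathcal S^\Box_2$ implies $q_1\xrightarrow{\alpha}_1\mathcal S^\Box_1$ with $\mathcal S^\Box_1\subseteq^{\preceq}\mathcal S^\Box_2$. $\mathcal C_1\preceq\mathcal C_2$ if $q_{0,1}\in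 Q_1$, $q_{0,2}\in Q_2$ and some modal refinement has $q_{0,1}\preceq q_{0,2}$. *)

theory Defs
  imports "HOL-Probability.Probability"
begin

text \<open>
  A set of variables together with their domains is a partial map \<open>X\<close> sending each
  variable \<open>x \<in> dom X\<close> to its domain; the values of all variables live in one common type.
\<close>

type_synonym ('x, 'v) vars = "'x \<rightharpoonup> 'v set"

definition states :: "('x, 'v) vars \<Rightarrow> ('x \<Rightarrow> 'v) set" where
  "states X = (\<Pi>\<^sub>E x\<in>dom X. the (X x))"

record ('w, 'x, 'v) mixed_system =
  ms_prob :: "'w measure"
  ms_vars :: "('x, 'v) vars"
  ms_rel :: "('w \<times> ('x \<Rightarrow> 'v)) set"

definition is_mixed_system :: "('w, 'x, 'v) mixed_system \<Rightarrow> bool" where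
  "is_mixed_system S \<longleftrightarrow>
     prob_space (ms_prob S) \<and>
     countable (space (ms_prob S)) \<and>
     sets (ms_prob S) = Pow (space (ms_prob S)) \<and>
     finite (dom (ms_vars S)) \<and>
     (\<forall>x\<in>dom (ms_vars S). countable (the (ms_vars S x))) \<and>
     ms_rel S \<subseteq> space (ms_prob S) \<times> states (ms_vars S)"

definition mixed_systems :: "('x, 'v) vars \<Rightarrow> ('w, 'x, 'v) mixed_system set" where
  "mixed_systems X = {S. is_mixed_system S \<and> ms_vars S = X}"

definition consistent :: "('w, 'x, 'v) mixed_system \<Rightarrow> bool" where
  "consistent S \<longleftrightarrow>
     measure (ms_prob S) {\<omega> \<in> space (ms_prob S). \<exists>q. (\<omega>, q) \<in> ms_rel S} > 0"

definition lift_rel ::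
  "(('x1 \<Rightarrow> 'v1) \<times> ('x2 \<Rightarrow> 'v2)) set \<Rightarrow>
   ('w1, 'x1, 'v1) mixed_system \<Rightarrow> ('w2, 'x2, 'v2) mixed_system \<Rightarrow> bool" where
  "lift_rel \<rho> S1 S2 \<longleftrightarrow>
     (\<exists>w :: 'w1 \<Rightarrow> 'w2 \<Rightarrow> real.
        (\<forall>\<omega>1\<in>space (ms_prob S1). \<forall>\<omega>2\<in>space (ms_prob S2). w \<omega>1 \<omega>2 \<in> {0..1}) \<and>
        (\<forall>\<omega>1\<in>space (ms_prob S1).
           ((\<lambda>\<omega>2. w \<omega>1 \<omega>2) has_sum measure (ms_prob S1) {\<omega>1}) (space (ms_prob S2))) \<and>
        (\<forall>\<omega>2\<in>space (ms_prob S2).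
           ((\<lambda>\<omega>1. w \<omega>1 \<omega>2) has_sum measure (ms_prob S2) {\<omega>2}) (space (ms_prob S1))) \<and>
        (\<forall>\<omega>1\<in>space (ms_prob S1). \<forall>\<omega>2\<in>space (ms_prob S2). \<forall>q1.
           w \<omega>1 \<omega>2 > 0 \<and> (\<omega>1, q1) \<in> ms_rel S1 \<longrightarrow>
           (\<exists>q2. (\<omega>2, q2) \<in> ms_rel S2 \<and> (q1, q2) \<in> \<rho>)))"

definition subset_lift ::
  "(('x1 \<Rightarrow> 'v1) \<times> ('x2 \<Rightarrow> 'v2)) set \<Rightarrow>
   ('w1, 'x1, 'v1) mixed_system set \<Rightarrow> ('w2, 'x2, 'v2) mixed_system set \<Rightarrow> bool" where
  "subset_lift \<rho> SS1 SS2 \<longleftrightarrow> (\<forall>S1\<in>SS1. \<exists>S2\<in>SS2. lift_rel \<rho> S1 S2)"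

definition in_lift ::
  "(('x1 \<Rightarrow> 'v1) \<times> ('x2 \<Rightarrow> 'v2)) set \<Rightarrow>
   ('w1, 'x1, 'v1) mixed_system \<Rightarrow> ('w2, 'x2, 'v2) mixed_system set \<Rightarrow> bool" where
  "in_lift \<rho> S SS \<longleftrightarrow> subset_lift \<rho> {S} SS"

definition deterministic :: "('q \<times> 'a \<times> 't) set \<Rightarrow> bool" where
  "deterministic T \<longleftrightarrow> (\<forall>q \<alpha> t t'. (q, \<alpha>, t) \<in> T \<and> (q, \<alpha>, t') \<in> T \<longrightarrow> t = t')"

record ('a, 'w, 'x, 'v) mmdp =
  mdp_alphabet :: "'a set"
  mdp_vars :: "('x, 'v) vars"
  mdp_init :: "'x \<Rightarrow> 'v"
  mdp_trans :: "(('x \<Rightarrow> 'v) \<times> 'a \<times> ('w, 'x, 'v) mixed_system) set"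

definition is_mmdp :: "('a, 'w, 'x, 'v) mmdp \<Rightarrow> bool" where
  "is_mmdp M \<longleftrightarrow>
     finite (dom (mdp_vars M)) \<and>
     (\<forall>x\<in>dom (mdp_vars M). countable (the (mdp_vars M x))) \<and>
     mdp_init M \<in> states (mdp_vars M) \<and>
     mdp_trans M \<subseteq> states (mdp_vars M) \<times> mdp_alphabet M \<times> mixed_systems (mdp_vars M) \<and>
     deterministic (mdp_trans M)"

definition live :: "('a, 'w, 'x, 'v) mmdp \<Rightarrow> bool" where
  "live M \<longleftrightarrow> (\<forall>(r, \<alpha>, S)\<in>mdp_trans M. consistent S)"

record ('a, 'w, 'x, 'v) mixed_interface =
  mi_alphabet :: "'a set"
  mi_vars :: "('x, 'v) vars"
  mi_init :: "'x \<Rightarrow> 'v"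
  mi_must :: "(('x \<Rightarrow> 'v) \<times> 'a \<times> ('w, 'x, 'v) mixed_system set) set"
  mi_may :: "(('x \<Rightarrow> 'v) \<times> 'a \<times> ('w, 'x, 'v) mixed_system set) set"

definition is_mixed_interface :: "('a, 'w, 'x, 'v) mixed_interface \<Rightarrow> bool" where
  "is_mixed_interface C \<longleftrightarrow>
     finite (dom (mi_vars C)) \<and>
     (\<forall>x\<in>dom (mi_vars C). finite (the (mi_vars C x))) \<and>
     mi_must C \<subseteq> states (mi_vars C) \<times> mi_alphabet C \<times> Pow (mixed_systems (mi_vars C)) \<and>
     mi_may C \<subseteq> states (mi_vars C) \<times> mi_alphabet C \<times> Pow (mixed_systems (mi_vars C)) \<and>
     deterministic (mi_must C) \<and>
     deterministic (mi_may C)"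

definition satisfaction_relation ::
  "('a, 'wm, 'xm, 'vm) mmdp \<Rightarrow> ('a, 'w, 'x, 'v) mixed_interface \<Rightarrow>
   (('xm \<Rightarrow> 'vm) \<times> ('x \<Rightarrow> 'v)) set \<Rightarrow> bool" where
  "satisfaction_relation M C \<rho> \<longleftrightarrow>
     \<rho> \<subseteq> states (mdp_vars M) \<times> states (mi_vars C) \<and>
     (\<forall>(r, q)\<in>\<rho>.
        (\<forall>\<alpha> S. (r, \<alpha>, S) \<in> mdp_trans M \<longrightarrow>
           (\<exists>SS. (q, \<alpha>, SS) \<in> mi_may C \<and> in_lift \<rho> S SS)) \<and>
        (\<forall>\<alpha> SS. (q, \<alpha>, SS) \<in> mi_must C \<longrightarrow>
           (\<exists>S. (r, \<alpha>, S) \<in> mdp_trans M \<and> in_lift \<rho> S SS)))"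

definition is_model ::
  "('a, 'wm, 'xm, 'vm) mmdp \<Rightarrow> ('a, 'w, 'x, 'v) mixed_interface \<Rightarrow> bool" where
  "is_model M C \<longleftrightarrow>
     is_mmdp M \<and> live M \<and>
     mdp_alphabet M = mi_alphabet C \<and>
     mi_init C \<in> states (mi_vars C) \<and>
     (\<exists>\<rho>. satisfaction_relation M C \<rho> \<and> (mdp_init M, mi_init C) \<in> \<rho>)"

definition modal_refinement ::
  "('a, 'w1, 'x1, 'v1) mixed_interface \<Rightarrow> ('a, 'w2, 'x2, 'v2) mixed_interface \<Rightarrow>
   (('x1 \<Rightarrow> 'v1) \<times> ('x2 \<Rightarrow> 'v2)) set \<Rightarrow> bool" where
  "modal_refinement C1 C2 \<rho> \<longleftrightarrow>
     \<rho> \<subseteq> states (mi_vars C1) \<times> states (mi_vars C2) \<and>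
     (\<forall>(q1, q2)\<in>\<rho>.
        (\<forall>\<alpha> SS1. (q1, \<alpha>, SS1) \<in> mi_may C1 \<longrightarrow>
           (\<exists>SS2. (q2, \<alpha>, SS2) \<in> mi_may C2 \<and> subset_lift \<rho> SS1 SS2)) \<and>
        (\<forall>\<alpha> SS2. (q2, \<alpha>, SS2) \<in> mi_must C2 \<longrightarrow>
           (\<exists>SS1. (q1, \<alpha>, SS1) \<in> mi_must C1 \<and> subset_lift \<rho> SS1 SS2)))"

definition mi_refines ::
  "('a, 'w1, 'x1, 'v1) mixed_interface \<Rightarrow> ('a, 'w2, 'x2, 'v2) mixed_interface \<Rightarrow> bool" where
  "mi_refines C1 C2 \<longleftrightarrow>
     mi_init C1 \<in> states (mi_vars C1) \<and>
     mi_init C2 \<in> states (mi_vars C2) \<and>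
     (\<exists>\<rho>. modal_refinement C1 C2 \<rho> \<and> (mi_init C1, mi_init C2) \<in> \<rho>)"

end

theory Submission
  imports Defs
begin

text \<open>
  Satisfaction and refinement compose because the lifting of relations to mixed systems does.
  Couplings \<open>u\<close> of \<open>\<pi>\<^sub>1, \<pi>\<^sub>2\<close> and \<open>v\<close> of \<open>\<pi>\<^sub>2, \<pi>\<^sub>3\<close> are glued along \<open>\<pi>\<^sub>2\<close>: the weight
  \<open>\<Sum>b. u a b * v b c / \<pi>\<^sub>2 b\<close> has marginals \<open>\<pi>\<^sub>1, \<pi>\<^sub>3\<close> by Tonelli, and where it is positive there
  is an intermediate \<open>b\<close> with \<open>u a b > 0\<close> and \<open>v b c > 0\<close>.
\<close>

text \<open>Nonnegativity turns convergence of the iterated sum into summability over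
  \<open>A \<times> B\<close>, where the order of summation may be exchanged. In the gluing below,
  \<open>x\<close> is always the intermediate outcome.\<close>

lemma has_sum_swap_nonneg:
  fixes f :: "'b \<Rightarrow> 'c \<Rightarrow> real"
  assumes nonneg: "\<And>x y. x \<in> A \<Longrightarrow> y \<in> B \<Longrightarrow> 0 \<le> f x y"
    and inner: "\<And>x. x \<in> A \<Longrightarrow> (f x has_sum g x) B"
    and outer: "(g has_sum s) A"
  shows "((\<lambda>y. \<Sum>\<^sub>\<infinity>x\<in>A. f x y) has_sum s) B"
proof -
  have sm: "(\<lambda>(x, y). f x y) summable_on A \<times> B"
    by (rule summable_on_SigmaI[where g = g]) (use assms in \<open>auto simp: has_sum_imp_summable\<close>)
  have "((\<lambda>(x, y). f x y) has_sum s) (A \<times> B)"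
    by (rule has_sum_SigmaI[where g = g]) (use inner outer sm in auto)
  then have swapped: "((\<lambda>(y, x). f x y) has_sum s) (B \<times> A)"
    by (subst (asm) has_sum_swap) simp
  have smx: "(\<lambda>x. f x y) summable_on A" if "y \<in> B" for y
    using summable_on_SigmaD1[OF has_sum_imp_summable[OF swapped] that] by simp
  show "((\<lambda>y. \<Sum>\<^sub>\<infinity>x\<in>A. f x y) has_sum s) B"
    by (rule has_sum_SigmaD[OF swapped]) (use smx in \<open>auto simp: has_sum_infsum\<close>)
qed

text \<open>Rescaling by \<open>k / p\<close> does this for nonzero \<open>p\<close>. For
  \<open>p = 0\<close> every summand is 0 by the convention for division by zero, so the sum can
  only be \<open>k\<close> if \<open>k\<close> vanishes too.\<close>

lemma has_sum_normalised:
  fixes k p :: real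
  assumes "(v has_sum p) C" and "p = 0 \<Longrightarrow> k = 0"
  shows "((\<lambda>c. k * v c / p) has_sum k) C"
  using has_sum_cmult_right[OF assms(1), of "k / p"] assms(2) by (cases "p = 0") auto

lemma has_sum_nonneg_ge_term:
  fixes f :: "'b \<Rightarrow> real"
  assumes "(f has_sum s) A" and "x \<in> A" and "\<And>y. y \<in> A \<Longrightarrow> 0 \<le> f y"
  shows "f x \<le> s"
  using finite_sum_le_has_sum[OF assms(1), of "{x}"] assms(2,3) by auto

lemma lift_rel_comp:
  assumes "prob_space (ms_prob S1)" and "lift_rel \<rho> S1 S2" and "lift_rel \<sigma> S2 S3"
  shows "lift_rel (\<rho> O \<sigma>) S1 S3"
proof -
  let ?A = "space (ms_prob S1)" and ?B = "space (ms_prob S2)" and ?C = "space (ms_prob S3)"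
  \<comment> \<open>The marginal shared by both couplings, and the normalising factor of the
    gluing.\<close>
  define p where "p b = measure (ms_prob S2) {b}" for b
  obtain u where u0: "\<And>a b. a \<in> ?A \<Longrightarrow> b \<in> ?B \<Longrightarrow> 0 \<le> u a b"
    and uA: "\<And>a. a \<in> ?A \<Longrightarrow> (u a has_sum measure (ms_prob S1) {a}) ?B"
    and uB: "\<And>b. b \<in> ?B \<Longrightarrow> ((\<lambda>a. u a b) has_sum p b) ?A"
    and u\<rho>: "\<And>a b q1. a \<in> ?A \<Longrightarrow> b \<in> ?B \<Longrightarrow> u a b > 0 \<Longrightarrow> (a, q1) \<in> ms_rel S1 \<Longrightarrow>
      \<exists>q2. (b, q2) \<in> ms_rel S2 \<and> (q1, q2) \<in> \<rho>"
    using assms(2)[unfolded lift_rel_def, folded p_def]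
    proof (elim exE conjE, goal_cases)
    case (1 w)
    show ?case
      by (rule 1(1)[of w]) (use 1(2-) in auto)
  qed
  obtain v where v0: "\<And>b c. b \<in> ?B \<Longrightarrow> c \<in> ?C \<Longrightarrow> 0 \<le> v b c"
    and vB: "\<And>b. b \<in> ?B \<Longrightarrow> (v b has_sum p b) ?C"
    and vC: "\<And>c. c \<in> ?C \<Longrightarrow> ((\<lambda>b. v b c) has_sum measure (ms_prob S3) {c}) ?B"
    and v\<sigma>: "\<And>b c q2. b \<in> ?B \<Longrightarrow> c \<in> ?C \<Longrightarrow> v b c > 0 \<Longrightarrow> (b, q2) \<in> ms_rel S2 \<Longrightarrow>
      \<exists>q3. (c, q3) \<in> ms_rel S3 \<and> (q2, q3) \<in> \<sigma>"
    using assms(3)[unfolded lift_rel_def, folded p_def]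
    proof (elim exE conjE, goal_cases)
    case (1 w)
    show ?case
      by (rule 1(1)[of w]) (use 1(2-) in auto)
  qed
  have p0: "0 \<le> p b" for b
    by (simp add: p_def)
  \<comment> \<open>Neither coupling puts mass on a null outcome \<open>b\<close>, so dividing by
    \<open>p b\<close> loses nothing.\<close>
  have u_null: "u a b = 0" if "a \<in> ?A" "b \<in> ?B" "p b = 0" for a b
    using has_sum_nonneg_ge_term[OF uB[OF that(2)] that(1)] u0 that by fastforce
  have v_null: "v b c = 0" if "b \<in> ?B" "c \<in> ?C" "p b = 0" for b c
    using has_sum_nonneg_ge_term[OF vB[OF that(1)] that(2)] v0 that by fastforce
  \<comment> \<open>This makes \<open>a\<close> and \<open>c\<close> conditionally independent given
    \<open>b\<close>.\<close>
  define w where "w a c = (\<Sum>\<^sub>\<infinity>b\<in>?B. u a b * v b c / p b)" for a c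
  \<comment> \<open>Summing over \<open>c\<close> first cancels \<open>p b\<close> and leaves
    \<open>u a b\<close>, whose sum over \<open>b\<close> is the first marginal. \<open>wC\<close>
    is the mirror image, with \<open>v b c\<close> left over.\<close>
  have wA: "(w a has_sum measure (ms_prob S1) {a}) ?C" if a: "a \<in> ?A" for a
    unfolding w_def
  proof (rule has_sum_swap_nonneg[where g = "u a"])
    show "((\<lambda>c. u a b * v b c / p b) has_sum u a b) ?C" if "b \<in> ?B" for b
      by (rule has_sum_normalised) (use vB u_null a that in auto)
  qed (use u0 v0 p0 uA a in auto)
  have wC: "((\<lambda>a. w a c) has_sum measure (ms_prob S3) {c}) ?A" if c: "c \<in> ?C" for c
    unfolding w_def
  proof (rule has_sum_swap_nonneg[where g = "\<lambda>b. v b c"])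
    show "((\<lambda>a. u a b * v b c / p b) has_sum v b c) ?A" if "b \<in> ?B" for b
      using has_sum_normalised[OF uB[OF that], of "v b c"] v_null c that
      by (simp add: mult.commute)
  qed (use u0 v0 p0 vC c in auto)
  have w0: "0 \<le> w a c" if "a \<in> ?A" "c \<in> ?C" for a c
    unfolding w_def using u0 v0 p0 that by (intro infsum_nonneg) auto
  \<comment> \<open>A single weight is at most its row sum, which is the probability of
    \<open>a\<close>.\<close>
  have w1: "w a c \<le> 1" if "a \<in> ?A" "c \<in> ?C" for a c
    using has_sum_nonneg_ge_term[OF wA[OF that(1)] that(2)] w0 that
      prob_space.prob_le_1[OF assms(1), of "{a}"] by fastforce
  have w_rel: "\<exists>q3. (c, q3) \<in> ms_rel S3 \<and> (q1, q3) \<in> \<rho> O \<sigma>"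
    if ac: "a \<in> ?A" "c \<in> ?C" and pos: "w a c > 0" and q1: "(a, q1) \<in> ms_rel S1" for a c q1
  proof -
    \<comment> \<open>A sum of zeros is zero, so some summand survives; its factors are nonzero and
      nonnegative, hence positive.\<close>
    have "\<exists>b\<in>?B. u a b * v b c / p b \<noteq> 0"
      using pos infsum_0[of ?B "\<lambda>b. u a b * v b c / p b"] unfolding w_def by fastforce
    then obtain b where b: "b \<in> ?B" "u a b > 0" "v b c > 0"
      using u0 v0 ac by (metis divide_eq_0_iff less_eq_real_def mult_eq_0_iff)
    then show ?thesis
      using u\<rho>[OF ac(1) b(1,2) q1] v\<sigma>[OF b(1) ac(2) b(3)] by blast
  qed
  show ?thesis
    unfolding lift_rel_def by (rule exI[of _ w]) (use w0 w1 wA wC w_rel in auto)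
qed

lemma in_lift_comp:
  assumes "prob_space (ms_prob S)" and "in_lift \<rho> S SS1" and "subset_lift \<sigma> SS1 SS2"
  shows "in_lift (\<rho> O \<sigma>) S SS2"
  using assms lift_rel_comp unfolding in_lift_def subset_lift_def by (metis singletonD singletonI)

text \<open>May obligations pass from \<open>M\<close> through \<open>C1\<close> to
  \<open>C2\<close>, must obligations from \<open>C2\<close> back through \<open>C1\<close> to
  \<open>M\<close>. In both cases the liftings compose in the same order, starting from the system
  \<open>S\<close> of \<open>M\<close>, which \<open>is_mmdp M\<close> guarantees to be a
  probability space.\<close>

lemma satisfaction_relation_comp:
  assumes "is_mmdp M" and sat: "satisfaction_relation M C1 \<rho>" and ref: "modal_refinement C1 C2 \<sigma>"
  shows "satisfaction_relation M C2 (\<rho> O \<sigma>)"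
proof -
  have prob: "prob_space (ms_prob S)" if "(r, \<alpha>, S) \<in> mdp_trans M" for r \<alpha> S
    using assms(1) that unfolding is_mmdp_def mixed_systems_def is_mixed_system_def by auto
  note sat_step = bspec[OF conjunct2[OF sat[unfolded satisfaction_relation_def]], simplified]
  note ref_step = bspec[OF conjunct2[OF ref[unfolded modal_refinement_def]], simplified]
  have "\<rho> O \<sigma> \<subseteq> states (mdp_vars M) \<times> states (mi_vars C2)"
    using sat ref unfolding satisfaction_relation_def modal_refinement_def by blast
  moreover have "\<exists>SS2. (q2, \<alpha>, SS2) \<in> mi_may C2 \<and> in_lift (\<rho> O \<sigma>) S SS2"
    if r: "(r, q1) \<in> \<rho>" and q: "(q1, q2) \<in> \<sigma>" and tr: "(r, \<alpha>, S) \<in> mdp_trans M" for r q1 q2 \<alpha> S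
  proof -
    obtain SS1 where 1: "(q1, \<alpha>, SS1) \<in> mi_may C1" "in_lift \<rho> S SS1"
      using sat_step[OF r] tr by blast
    then obtain SS2 where "(q2, \<alpha>, SS2) \<in> mi_may C2" "subset_lift \<sigma> SS1 SS2"
      using ref_step[OF q] by blast
    then show ?thesis
      using in_lift_comp[OF prob[OF tr] 1(2)] by blast
  qed
  moreover have "\<exists>S. (r, \<alpha>, S) \<in> mdp_trans M \<and> in_lift (\<rho> O \<sigma>) S SS2"
    if r: "(r, q1) \<in> \<rho>" and q: "(q1, q2) \<in> \<sigma>" and tr: "(q2, \<alpha>, SS2) \<in> mi_must C2" for r q1 q2 \<alpha> SS2
  proof -
    obtain SS1 where 1: "(q1, \<alpha>, SS1) \<in> mi_must C1" "subset_lift \<sigma> SS1 SS2"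
      using ref_step[OF q] tr by blast
    then obtain S where "(r, \<alpha>, S) \<in> mdp_trans M" "in_lift \<rho> S SS1"
      using sat_step[OF r] by blast
    then show ?thesis
      using in_lift_comp[OF prob _ 1(2)] by blast
  qed
  ultimately show ?thesis
    unfolding satisfaction_relation_def by blast
qed

theorem theorem2:
  fixes \<Sigma> :: "'a set"
    and C1 :: "('a, 'w1, 'x1, 'v1) mixed_interface"
    and C2 :: "('a, 'w2, 'x2, 'v2) mixed_interface"
  assumes "is_mixed_interface C1" and "mi_alphabet C1 = \<Sigma>"
    and "is_mixed_interface C2" and "mi_alphabet C2 = \<Sigma>"
    and "mi_refines C1 C2"
  shows "\<forall>M :: ('a, 'wm, 'xm, 'vm) mmdp. is_model M C1 \<longrightarrow> is_model M C2"
proof (intro allI impI)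
  fix M :: "('a, 'wm, 'xm, 'vm) mmdp"
  assume model: "is_model M C1"
  then obtain \<rho> where "satisfaction_relation M C1 \<rho>" "(mdp_init M, mi_init C1) \<in> \<rho>"
    unfolding is_model_def by blast
  moreover obtain \<sigma> where "modal_refinement C1 C2 \<sigma>" "(mi_init C1, mi_init C2) \<in> \<sigma>"
    using assms(5) unfolding mi_refines_def by blast
  ultimately have "satisfaction_relation M C2 (\<rho> O \<sigma>)" "(mdp_init M, mi_init C2) \<in> \<rho> O \<sigma>"
    using satisfaction_relation_comp model unfolding is_model_def by blast+
  \<comment> \<open>The alphabets agree through \<Sigma>, and refinement itself places
    \<open>mi_init C2\<close> in the state space of \<open>C2\<close>.\<close>
  then show "is_model M C2"
    using model assms(2,4,5) unfolding is_model_def mi_refines_def by auto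
qed

end
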